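(* The free group $F_\infty=\langle x_1,x_2,x_3,\dots\mid -\rangle$ on the countable set of generators $Y=\{x_i\mid i\in\mathbb Z_{+}\}$ is deterministic non-blind $2$-counter-graph automatic; that is, with $X=Y\cup Y^{-1}$ there is a finite set of symbols $\Lambda$ such that $(F_\infty,X,\Lambda)$ is $\mathcal C$-graph automatic, where $\mathcal C$ is the class of languages accepted by deterministic non-blind $2$-counter automata.
   Context: A normal form for $(G,X,\Lambda)$ is a set $L\subseteq\Lambda^*$ in bijection with $G$; the image of $u\in L$ is denoted $\overline u$. Convolution: let $\diamond\notin\Lambda$ and $\Lambda_\diamond=\Lambda\cup\{\diamond\}$. For $u,v\in\Lambda^*$, $\otimes(u,v)$ is the word of length $\max(|u|,|v|)$ over $(\Lambda_\diamond)^2$ whose $i$th letter has first component the $i$th letter of $u$ if $i\le|u|$ and $\diamond$ otherwise, and second component the $i$th letter of $v$ if $i\le|v|$ and $\diamond$ otherwise. For a group $G$ with symmetric (closed under inverses, possibly infinite) generating set $X$ and a finite set of symbols $\Lambda$, $(G,X,\Lambda)$ is $\mathcal C$-graph automatic if there is a normal form $L\subseteq\Lambda^*$ in $\mathcal C$ such that for each $x\in X$ the language $L_x=\{\otimes(u,v)\mid u,v\in L,\ \overline v=_G\overline u x\}$ is in $\mathcal C$. A deterministic non-blind $k$-counter automaton is a deterministic finite state automaton (without $\epsilon$-transitions) augmented with $k$ integer counters, all initialized to zero, which can be incremented or decremented (by fixed integers), compared to zero and set to zero during operation; which transition is taken on reading a letter may depend on which counters are zero. It accepts a word exactly if, having read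 it, it is in an accepting state with all counters equal to zero. *)

theory Defs
  imports "HOL-Algebra.Generated_Groups"
begin

section \<open>Counter automata\<close>

datatype counter_op = Add int | Reset

fun apply_op :: "counter_op \<Rightarrow> int \<Rightarrow> int" where
  "apply_op (Add d) n = n + d"
| "apply_op Reset n = 0"

text \<open>
  The third argument of \<open>transition\<close> is the set of those counters (numbered from \<open>0\<close> to \<open>counters - 1\<close>)
  whose value is zero before the transition. The automaton is deterministic but may be partial:
  \<open>None\<close> means that there is no move and the input is rejected.
\<close>

record ('q, 'a) counter_automaton =
  counters :: nat
  states :: "'q set"
  alphabet :: "'a set"
  init :: 'q
  accepting :: "'q set"
  transition :: "'q \<Rightarrow> 'a \<Rightarrow> nat set \<Rightarrow> ('q \<times> (nat \<Rightarrow> counter_op)) option"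

definition wf_automaton :: "('q, 'a) counter_automaton \<Rightarrow> bool" where
  "wf_automaton M \<longleftrightarrow>
     finite (states M) \<and> finite (alphabet M) \<and> init M \<in> states M \<and> accepting M \<subseteq> states M \<and>
     (\<forall>q \<in> states M. \<forall>a \<in> alphabet M. \<forall>Z. Z \<subseteq> {..<counters M} \<longrightarrow>
        (\<forall>q' ops. transition M q a Z = Some (q', ops) \<longrightarrow> q' \<in> states M))"

definition step ::
  "('q, 'a) counter_automaton \<Rightarrow> 'q \<times> (nat \<Rightarrow> int) \<Rightarrow> 'a \<Rightarrow> ('q \<times> (nat \<Rightarrow> int)) option" where
  "step M = (\<lambda>(q, c) a.
     case transition M q a {i. i < counters M \<and> c i = 0} of
       None \<Rightarrow> None
     | Some (q', ops) \<Rightarrow> Some (q', \<lambda>i. apply_op (ops i) (c i)))"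

fun run ::
  "('q, 'a) counter_automaton \<Rightarrow> 'q \<times> (nat \<Rightarrow> int) \<Rightarrow> 'a list \<Rightarrow> ('q \<times> (nat \<Rightarrow> int)) option" where
  "run M s [] = Some s"
| "run M s (a # w) = (case step M s a of None \<Rightarrow> None | Some s' \<Rightarrow> run M s' w)"

definition accepts :: "('q, 'a) counter_automaton \<Rightarrow> 'a list \<Rightarrow> bool" where
  "accepts M w \<longleftrightarrow>
     (\<exists>q c. run M (init M, \<lambda>_. 0) w = Some (q, c) \<and> q \<in> accepting M \<and> (\<forall>i < counters M. c i = 0))"

definition language :: "('q, 'a) counter_automaton \<Rightarrow> 'a list set" where
  "language M = {w \<in> lists (alphabet M). accepts M w}"

text \<open>Since state sets are finite, naming the states by natural numbers is no restriction.\<close>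

definition counter_languages :: "nat \<Rightarrow> 'a list set set" where
  "counter_languages k =
     {language M | M :: (nat, 'a) counter_automaton. wf_automaton M \<and> counters M = k}"


section \<open>Graph automatic groups\<close>

text \<open>The padding symbol is \<open>None\<close>; the letters of an alphabet \<open>\<Lambda>\<close> appear as \<open>Some a\<close>.\<close>

definition convolution :: "'l list \<Rightarrow> 'l list \<Rightarrow> ('l option \<times> 'l option) list" where
  "convolution u v =
     map (\<lambda>i. (if i < length u then Some (u ! i) else None,
               if i < length v then Some (v ! i) else None))
       [0..<max (length u) (length v)]"

definition normal_form :: "('g, 'm) monoid_scheme \<Rightarrow> 'l set \<Rightarrow> 'l list set \<Rightarrow> ('l list \<Rightarrow> 'g) \<Rightarrow> bool" where
  "normal_form G \<Lambda> L \<phi> \<longleftrightarrow> L \<subseteq> lists \<Lambda> \<and> bij_betw \<phi> L (carrier G)"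

text \<open>
  A class of languages contains languages over different alphabets. As variables in HOL are not
  polymorphic, the class is passed twice: \<open>C\<close> is its instance for words over \<open>\<Lambda>\<close>, and \<open>C2\<close> its
  instance for convolutions of such words.
\<close>

definition graph_automatic ::
  "'l list set set \<Rightarrow> ('l option \<times> 'l option) list set set \<Rightarrow>
   ('g, 'm) monoid_scheme \<Rightarrow> 'g set \<Rightarrow> 'l set \<Rightarrow> bool" where
  "graph_automatic C C2 G X \<Lambda> \<longleftrightarrow>
     group G \<and> X \<subseteq> carrier G \<and> generate G X = carrier G \<and> (\<forall>x \<in> X. inv\<^bsub>G\<^esub> x \<in> X) \<and> finite \<Lambda> \<and>
     (\<exists>L \<phi>. normal_form G \<Lambda> L \<phi> \<and> L \<in> C \<and>
        (\<forall>x \<in> X. {convolution u v | u v. u \<in> L \<and> v \<in> L \<and> \<phi> v = \<phi> u \<otimes>\<^bsub>G\<^esub> x} \<in> C2))"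


section \<open>Free groups\<close>

text \<open>
  Words in the letters \<open>(a, True)\<close>, standing for the generator \<open>a\<close>, and \<open>(a, False)\<close>, standing
  for its formal inverse, modulo insertion and deletion of mutually inverse adjacent letters.
\<close>

definition group_words :: "'a set \<Rightarrow> ('a \<times> bool) list set" where
  "group_words S = lists (S \<times> UNIV)"

definition cancellation :: "'a set \<Rightarrow> (('a \<times> bool) list \<times> ('a \<times> bool) list) set" where
  "cancellation S =
     {(u @ [(a, e), (a, \<not> e)] @ v, u @ v) | u v a e. u \<in> group_words S \<and> v \<in> group_words S \<and> a \<in> S}"

definition free_equiv :: "'a set \<Rightarrow> (('a \<times> bool) list \<times> ('a \<times> bool) list) set" where
  "free_equiv S = Restr ((cancellation S \<union> (cancellation S)\<inverse>)\<^sup>*) (group_words S)"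

definition free_group :: "'a set \<Rightarrow> ('a \<times> bool) list set monoid" where
  "free_group S =
     \<lparr> carrier = group_words S // free_equiv S,
       mult = (\<lambda>P Q. free_equiv S `` {p @ q | p q. p \<in> P \<and> q \<in> Q}),
       one = free_equiv S `` {[]} \<rparr>"

definition free_generator :: "'a set \<Rightarrow> 'a \<Rightarrow> ('a \<times> bool) list set" where
  "free_generator S a = free_equiv S `` {[(a, True)]}"

lemma equiv_free_equiv: "equiv (group_words S) (free_equiv S)"
proof (rule equivI)
  show "free_equiv S \<subseteq> group_words S \<times> group_words S"
    by (auto simp: free_equiv_def)
  show "refl_on (group_words S) (free_equiv S)"
    by (auto simp: free_equiv_def refl_on_def)
  have "sym ((cancellation S \<union> (cancellation S)\<inverse>)\<^sup>*)"
    by (intro sym_rtrancl sym_Un_converse)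
  then show "sym (free_equiv S)"
    by (auto simp: free_equiv_def sym_def)
  show "trans (free_equiv S)"
    unfolding free_equiv_def trans_def by (auto intro: rtrancl_trans)
qed

lemma free_equiv_append_context:
  assumes "(p, q) \<in> free_equiv S" "u \<in> group_words S" "v \<in> group_words S"
  shows "(u @ p @ v, u @ q @ v) \<in> free_equiv S"
proof -
  let ?R = "cancellation S \<union> (cancellation S)\<inverse>"
  have canc: "(u @ p @ v, u @ q @ v) \<in> cancellation S" if pq: "(p, q) \<in> cancellation S" for p q
  proof -
    obtain s t a e where "p = s @ [(a, e), (a, \<not> e)] @ t" "q = s @ t"
      "s \<in> group_words S" "t \<in> group_words S" "a \<in> S"
      using pq by (auto simp: cancellation_def)
    moreover have "u @ s \<in> group_words S" "t @ v \<in> group_words S"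
      using assms(2,3) calculation by (auto simp: group_words_def)
    ultimately show ?thesis
      unfolding cancellation_def
      by (intro CollectI exI[of _ "u @ s"] exI[of _ "t @ v"] exI[of _ a] exI[of _ e]) simp
  qed
  have "(p, q) \<in> ?R\<^sup>*"
    using assms(1) by (auto simp: free_equiv_def)
  then have "(u @ p @ v, u @ q @ v) \<in> ?R\<^sup>*"
  proof induction
    case (step y z)
    then have "(u @ y @ v, u @ z @ v) \<in> ?R"
      using canc by auto
    with step.IH show ?case
      by (rule rtrancl_into_rtrancl)
  qed simp
  moreover have "p \<in> group_words S" "q \<in> group_words S"
    using assms(1) by (auto simp: free_equiv_def)
  ultimately show ?thesis
    using assms(2,3) by (auto simp: free_equiv_def group_words_def)
qed

lemma free_equiv_append:
  assumes "(p, p') \<in> free_equiv S" "(q, q') \<in> free_equiv S"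
  shows "(p @ q, p' @ q') \<in> free_equiv S"
proof -
  have "p' \<in> group_words S" "q \<in> group_words S" "[] \<in> group_words S"
    using assms by (auto simp: free_equiv_def group_words_def)
  then have "(p @ q, p' @ q) \<in> free_equiv S" "(p' @ q, p' @ q') \<in> free_equiv S"
    using free_equiv_append_context[OF assms(1), of "[]" q]
      free_equiv_append_context[OF assms(2), of p' "[]"] by auto
  then show ?thesis
    using equiv_free_equiv[of S] by (meson equivE transD)
qed

lemma free_group_mult_class:
  assumes "p \<in> group_words S" "q \<in> group_words S"
  shows "(free_equiv S `` {p}) \<otimes>\<^bsub>free_group S\<^esub> (free_equiv S `` {q}) = free_equiv S `` {p @ q}"
proof -
  let ?E = "free_equiv S"
  have self: "(p, p) \<in> ?E" "(q, q) \<in> ?E"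
    using assms by (auto simp: free_equiv_def)
  have tr: "(x, z) \<in> ?E" if "(x, y) \<in> ?E" "(y, z) \<in> ?E" for x y z
    using that equiv_free_equiv[of S] by (meson equivE transD)
  have "?E `` {p' @ q' | p' q'. (p, p') \<in> ?E \<and> (q, q') \<in> ?E} = ?E `` {p @ q}" (is "?l = ?r")
  proof
    show "?l \<subseteq> ?r"
      using tr free_equiv_append by blast
    show "?r \<subseteq> ?l"
      using self by blast
  qed
  then show ?thesis
    by (simp add: free_group_def)
qed

lemma group_free_group: "group (free_group S)"
proof -
  have car: "P \<in> carrier (free_group S) \<longleftrightarrow> (\<exists>p \<in> group_words S. P = free_equiv S `` {p})" for P
    by (auto simp: free_group_def quotient_def)
  have one: "\<one>\<^bsub>free_group S\<^esub> = free_equiv S `` {[]}"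
    by (simp add: free_group_def)
  have app: "p @ q \<in> group_words S" if "p \<in> group_words S" "q \<in> group_words S" for p q
    using that by (auto simp: group_words_def)
  have nil: "[] \<in> group_words S"
    by (simp add: group_words_def)
  define iv where "iv = (\<lambda>p :: ('a \<times> bool) list. rev (map (\<lambda>(a, e). (a, \<not> e)) p))"
  have iv: "iv p \<in> group_words S \<and> (iv p @ p, []) \<in> free_equiv S" if "p \<in> group_words S" for p
    using that
  proof (induction p)
    case Nil
    then show ?case by (simp add: iv_def free_equiv_def)
  next
    case (Cons x p)
    obtain a e where x: "x = (a, e)" by force
    have a: "a \<in> S" and p: "p \<in> group_words S"
      using Cons.prems by (auto simp: x group_words_def)
    have eq: "iv ((a, e) # p) = iv p @ [(a, \<not> e)]"
      by (simp add: iv_def)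
    have ip: "iv p \<in> group_words S" and IH: "(iv p @ p, []) \<in> free_equiv S"
      using Cons.IH p by auto
    have "(iv p @ [(a, \<not> e), (a, \<not> \<not> e)] @ p, iv p @ p) \<in> cancellation S"
      unfolding cancellation_def using ip p a by blast
    then have "(iv (x # p) @ x # p, iv p @ p) \<in> free_equiv S"
      using ip p a unfolding x eq by (auto simp: free_equiv_def group_words_def)
    with IH have "(iv (x # p) @ x # p, []) \<in> free_equiv S"
      using equiv_free_equiv[of S] by (meson equivE transD)
    then show ?case
      using ip a unfolding x eq by (auto simp: group_words_def)
  qed
  show ?thesis
  proof (rule groupI)
    show "\<one>\<^bsub>free_group S\<^esub> \<in> carrier (free_group S)"
      using nil by (auto simp: car one)
  next
    fix P Q assume "P \<in> carrier (free_group S)" "Q \<in> carrier (free_group S)"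
    then show "P \<otimes>\<^bsub>free_group S\<^esub> Q \<in> carrier (free_group S)"
      using app by (auto simp: car free_group_mult_class)
  next
    fix P Q R
    assume "P \<in> carrier (free_group S)" "Q \<in> carrier (free_group S)" "R \<in> carrier (free_group S)"
    then show "P \<otimes>\<^bsub>free_group S\<^esub> Q \<otimes>\<^bsub>free_group S\<^esub> R = P \<otimes>\<^bsub>free_group S\<^esub> (Q \<otimes>\<^bsub>free_group S\<^esub> R)"
      using app by (auto simp: car free_group_mult_class)
  next
    fix P assume "P \<in> carrier (free_group S)"
    then show "\<one>\<^bsub>free_group S\<^esub> \<otimes>\<^bsub>free_group S\<^esub> P = P"
      using nil by (auto simp: car one free_group_mult_class)
  next
    fix P assume "P \<in> carrier (free_group S)"
    then obtain p where p: "p \<in> group_words S" "P = free_equiv S `` {p}"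
      by (auto simp: car)
    have "free_equiv S `` {iv p} \<otimes>\<^bsub>free_group S\<^esub> P = \<one>\<^bsub>free_group S\<^esub>"
      using iv[OF p(1)] p equiv_class_eq[OF equiv_free_equiv]
      by (auto simp: free_group_mult_class one)
    then show "\<exists>Q \<in> carrier (free_group S). Q \<otimes>\<^bsub>free_group S\<^esub> P = \<one>\<^bsub>free_group S\<^esub>"
      using iv[OF p(1)] car by blast
  qed
qed

definition F_inf :: "(nat \<times> bool) list set monoid" where
  "F_inf = free_group {1..}"

definition F_inf_gens :: "(nat \<times> bool) list set set" where
  "F_inf_gens = free_generator {1..} ` {1..}"

end

theory Submission
  imports Defs
begin

text \<open>
  Every element of a free group is the class of exactly one reduced word. The letter \<open>(a, e)\<close> is
  written in unary, as a sign followed by \<open>a - 1\<close> ticks, and an end marker closes the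
  word; the normal form \<open>L\<close> consists of the encodings of reduced words. A word fails to be reduced
  only if two adjacent letters have opposite signs and equal index, that is, if two adjacent
  blocks of ticks of opposite sign have the same length. Two counters detect this: one
  counts the current block while the other, which holds the length of the previous block,
  is decremented; at the end of the block the second counter is zero exactly if the lengths agree.
  Then the counters exchange their roles, since the block just counted has to be
  compared with the next one. The end marker resets both counters, so that acceptance with zero
  counters costs nothing (\<open>language_reader\<close>).

  Multiplying a reduced word on the right by a letter \<open>x\<close> either appends \<open>x\<close> or
  deletes a final inverse of \<open>x\<close>. Hence the convolution of the two encodings consists of a
  diagonal part followed by a tail that belongs to \<open>x\<close>. As \<open>x\<close> is fixed, the tail is
  one of two fixed words, so this shape is recognized without counters. What remains
  to be checked is that both components lie in \<open>L\<close>. It suffices to look at the longer one,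
  because prefixes of reduced words are reduced, and the longer one is obtained from the convolution
  letter by letter. So the language of the pairs is the intersection of a regular language with the
  preimage of \<open>L\<close> under a letter-to-letter map, and languages of counter automata are closed under
  this operation (\<open>counter_languages_vimage_Int\<close>).
\<close>

section \<open>Languages of counter automata\<close>

text \<open>
  Acceptance from an arbitrary configuration is what an induction on the remaining input can
  speak about.
\<close>

definition accepts_from ::
  "('q, 'a) counter_automaton \<Rightarrow> 'q \<times> (nat \<Rightarrow> int) \<Rightarrow> 'a list \<Rightarrow> bool" where
  "accepts_from M s w \<longleftrightarrow>
     (\<exists>q c. run M s w = Some (q, c) \<and> q \<in> accepting M \<and> (\<forall>i < counters M. c i = 0))"

lemma accepts_from_Nil:
  "accepts_from M (q, c) [] \<longleftrightarrow> q \<in> accepting M \<and> (\<forall>i < counters M. c i = 0)"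
  by (simp add: accepts_from_def)

lemma accepts_from_Cons:
  "accepts_from M (q, c) (a # w) \<longleftrightarrow>
     (case transition M q a {i. i < counters M \<and> c i = 0} of
        None \<Rightarrow> False
      | Some (q', ops) \<Rightarrow> accepts_from M (q', \<lambda>i. apply_op (ops i) (c i)) w)"
  by (simp add: accepts_from_def step_def split: option.split)

lemma language_eq: "language M = {w \<in> lists (alphabet M). accepts_from M (init M, \<lambda>_. 0) w}"
  by (simp add: language_def accepts_def accepts_from_def)

lemma wf_automaton_closed:
  assumes "wf_automaton M" "q \<in> states M" "a \<in> alphabet M"
    and "transition M q a {i. i < counters M \<and> c i = 0} = Some (q', ops)"
  shows "q' \<in> states M"
  using assms unfolding wf_automaton_def
  by (metis (mono_tags, lifting) lessThan_iff mem_Collect_eq subsetI)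

text \<open>
  A finite state set embeds into the natural numbers, so concrete automata may use their own
  types of states.
\<close>

lemma language_in_counter_languages:
  assumes wf: "wf_automaton M"
  shows "language M \<in> counter_languages (counters M)"
proof -
  have "finite (states M)"
    using wf by (simp add: wf_automaton_def)
  then obtain f :: "'a \<Rightarrow> nat" where f: "inj_on f (states M)"
    using finite_imp_inj_to_nat_seg by metis
  let ?g = "inv_into (states M) f"
  define N where "N = \<lparr> counters = counters M, states = f ` states M, alphabet = alphabet M,
    init = f (init M), accepting = f ` accepting M,
    transition = (\<lambda>n a Z. map_option (\<lambda>(q, ops). (f q, ops)) (transition M (?g n) a Z)) \<rparr>"
  have acc: "accepting M \<subseteq> states M" and init: "init M \<in> states M"
    using wf by (auto simp: wf_automaton_def)
  have "accepts_from N (f q, c) w \<longleftrightarrow> accepts_from M (q, c) w"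
    if "q \<in> states M" "w \<in> lists (alphabet M)" for q c w
    using that
  proof (induction w arbitrary: q c)
    case Nil
    then show ?case
      using acc inj_on_image_mem_iff[OF f] by (auto simp: accepts_from_Nil N_def)
  next
    case (Cons a w)
    show ?case
    proof (cases "transition M q a {i. i < counters M \<and> c i = 0}")
      case None
      then show ?thesis
        using Cons.prems f by (simp add: accepts_from_Cons N_def)
    next
      case (Some t)
      obtain q' ops where t: "t = (q', ops)" by force
      have "q' \<in> states M"
        using Cons.prems Some t wf by (auto intro: wf_automaton_closed)
      then have "accepts_from N (f q', \<lambda>i. apply_op (ops i) (c i)) w \<longleftrightarrow>
          accepts_from M (q', \<lambda>i. apply_op (ops i) (c i)) w"
        using Cons by auto
      moreover have "transition N (f q) a {i. i < counters N \<and> c i = 0} = Some (f q', ops)"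
        using Cons.prems f Some t by (simp add: N_def)
      ultimately show ?thesis
        using Some t by (simp add: accepts_from_Cons)
    qed
  qed
  then have "language N = language M"
    using init by (auto simp: language_eq N_def)
  moreover have "wf_automaton N"
  proof -
    have "q' \<in> f ` states M"
      if q: "q \<in> states M" and a: "a \<in> alphabet M" and Z: "Z \<subseteq> {..<counters M}"
        and tr: "transition N (f q) a Z = Some (q', ops)" for q a Z q' ops
    proof -
      obtain r where "transition M q a Z = Some (r, ops)" "q' = f r"
        using tr q f by (auto simp: N_def)
      then show ?thesis
        using wf q a Z unfolding wf_automaton_def by blast
    qed
    then show ?thesis
      using wf unfolding wf_automaton_def by (auto simp: N_def)
  qed
  moreover have "counters N = counters M"
    by (simp add: N_def)
  ultimately show ?thesis
    unfolding counter_languages_def by blast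
qed

text \<open>
  The product of the two automata, where the first one reads the image of each letter under \<open>h\<close>.
  The language \<open>R\<close> is regular: its automaton has no counters, so the product needs
  only the \<open>k\<close> counters of the first one.
\<close>

lemma counter_languages_vimage_Int:
  assumes "L \<in> counter_languages k" "R \<in> counter_languages 0"
  shows "{w \<in> R. map h w \<in> L} \<in> counter_languages k"
proof -
  obtain M :: "(nat, 'a) counter_automaton" where
    M: "L = language M" "wf_automaton M" "counters M = k"
    using assms(1) by (auto simp: counter_languages_def)
  obtain D :: "(nat, 'b) counter_automaton" where
    D: "R = language D" "wf_automaton D" "counters D = 0"
    using assms(2) by (auto simp: counter_languages_def)
  define P where "P = \<lparr> counters = k, states = states M \<times> states D, alphabet = alphabet D,
    init = (init M, init D), accepting = accepting M \<times> accepting D,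
    transition = (\<lambda>(q, d) a Z.
      if h a \<in> alphabet M then
        (case transition M q (h a) Z of None \<Rightarrow> None
         | Some (q', ops) \<Rightarrow> map_option (\<lambda>(d', _). ((q', d'), ops)) (transition D d a {}))
      else None) \<rparr>"
  \<comment> \<open>The counter contents \<open>e\<close> of an automaton without counters are arbitrary; the induction needs this
    freedom because the operations of \<open>D\<close> still change them formally.\<close>
  have run: "accepts_from P ((q, d), c) w \<longleftrightarrow>
      map h w \<in> lists (alphabet M) \<and> accepts_from M (q, c) (map h w) \<and> accepts_from D (d, e) w"
    for q d c e w
  proof (induction w arbitrary: q d c e)
    case Nil
    then show ?case
      using M D by (auto simp: accepts_from_Nil P_def)
  next
    case (Cons a w)
    have tP: "transition P (q, d) a {i. i < counters P \<and> c i = 0} =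
      (if h a \<in> alphabet M then
        (case transition M q (h a) {i. i < counters M \<and> c i = 0} of None \<Rightarrow> None
         | Some (q', ops) \<Rightarrow> map_option (\<lambda>(d', _). ((q', d'), ops)) (transition D d a {}))
      else None)"
      by (simp add: P_def M(3))
    have tD: "{i. i < counters D \<and> e i = 0} = {}"
      by (simp add: D(3))
    show ?case
    proof (cases "transition M q (h a) {i. i < counters M \<and> c i = 0}")
      case None
      then show ?thesis
        unfolding list.map accepts_from_Cons tP by simp
    next
      case M: (Some t)
      obtain q' ops where t: "t = (q', ops)" by force
      show ?thesis
      proof (cases "transition D d a {}")
        case None
        then show ?thesis
          unfolding list.map accepts_from_Cons tP tD M t by simp
      next
        case D: (Some u)
        obtain d' ops' where u: "u = (d', ops')" by force
        show ?thesis
          unfolding list.map accepts_from_Cons tP tD M t D u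
          using Cons.IH[of q' d' "\<lambda>i. apply_op (ops i) (c i)" "\<lambda>i. apply_op (ops' i) (e i)"]
          by simp
      qed
    qed
  qed
  have "language P = {w \<in> R. map h w \<in> L}"
    unfolding M(1) D(1) language_eq using run[of "init M" "init D" "\<lambda>_. 0" _ "\<lambda>_. 0"]
    by (auto simp: P_def)
  moreover have "wf_automaton P"
  proof -
    have "q' \<in> states M \<times> states D"
      if "q \<in> states M \<times> states D" "a \<in> alphabet D" "Z \<subseteq> {..<k}"
        and tr: "transition P q a Z = Some (q', ops)" for q a Z q' ops
    proof -
      obtain q1 q2 where q: "q = (q1, q2)" by force
      obtain r1 ops' r2 x where "h a \<in> alphabet M" "transition M q1 (h a) Z = Some (r1, ops')"
        "transition D q2 a {} = Some (r2, x)" "q' = (r1, r2)"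
        using tr by (auto simp: q P_def split: if_splits option.splits)
      then show ?thesis
        using that M D unfolding q wf_automaton_def by fastforce
    qed
    moreover have "states P = states M \<times> states D" "alphabet P = alphabet D" "counters P = k"
      "init P = (init M, init D)" "accepting P = accepting M \<times> accepting D"
      by (simp_all add: P_def)
    moreover have "finite (states M \<times> states D)" "finite (alphabet D)"
      "(init M, init D) \<in> states M \<times> states D"
      "accepting M \<times> accepting D \<subseteq> states M \<times> states D"
      using M(2) D(2) by (auto simp: wf_automaton_def)
    ultimately show ?thesis
      unfolding wf_automaton_def by simp
  qed
  moreover have "counters P = k"
    by (simp add: P_def)
  ultimately show ?thesis
    using language_in_counter_languages[of P] by simp
qed

section \<open>Encoding of reduced words\<close>

definition cancels :: "'a \<times> bool \<Rightarrow> 'a \<times> bool \<Rightarrow> bool" where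
  "cancels x y \<longleftrightarrow> fst x = fst y \<and> snd x \<noteq> snd y"

definition reduced :: "('a \<times> bool) list \<Rightarrow> bool" where
  "reduced r \<longleftrightarrow> successively (\<lambda>x y. \<not> cancels x y) r"

definition reduced_words :: "'a set \<Rightarrow> ('a \<times> bool) list set" where
  "reduced_words S = {r \<in> group_words S. reduced r}"

text \<open>
  The letters \<open>0\<close> and \<open>1\<close> are the two signs, \<open>2\<close> is the tick and \<open>3\<close> the end marker. The sign
  already counts for one, so every word over \<open>{0, 1, 2}\<close> that begins with a sign is a sequence of
  blocks of letters of positive index, and an automaton has nothing to check about the form
  of a single block.
\<close>

definition block :: "nat \<times> bool \<Rightarrow> nat list" where
  "block x = of_bool (snd x) # replicate (fst x - 1) 2"

definition encode :: "(nat \<times> bool) list \<Rightarrow> nat list" where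
  "encode r = concat (map block r) @ [3]"

lemma reduced_Cons_Cons: "reduced (x # y # r) \<longleftrightarrow> \<not> cancels x y \<and> reduced (y # r)"
  by (simp add: reduced_def)

section \<open>A two-counter automaton for reduced words\<close>

text \<open>
  In \<open>Reading p e opp\<close> the current block has sign \<open>e\<close> and its ticks are counted by counter \<open>p\<close>, while
  counter \<open>1 - p\<close> holds the difference of the previous and the current block. The flag \<open>opp\<close> records
  that the previous block has the opposite sign, and only then is a difference of zero an error.
\<close>

datatype reader = Start | Reading nat bool bool | Halted

fun reader_step ::
  "reader \<Rightarrow> nat \<Rightarrow> nat set \<Rightarrow> (reader \<times> (nat \<Rightarrow> counter_op)) option" where
  "reader_step Start a Z =
     (if a \<le> 1 then Some (Reading 0 (a = 1) False, \<lambda>_. Reset)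
      else if a = 3 then Some (Halted, \<lambda>_. Reset)
      else None)"
| "reader_step (Reading p e opp) a Z =
     (if a = 2 then Some (Reading p e opp, \<lambda>i. if i = p then Add 1 else Add (- 1))
      else if opp \<and> 1 - p \<in> Z then None
      else if a = 3 then Some (Halted, \<lambda>_. Reset)
      else Some (Reading (1 - p) (a = 1) (e \<noteq> (a = 1)), \<lambda>i. if i = p then Add 0 else Reset))"
| "reader_step Halted a Z = None"

definition reader_automaton :: "(reader, nat) counter_automaton" where
  "reader_automaton = \<lparr> counters = 2,
     states = {Start, Halted} \<union> (\<lambda>(p, e, opp). Reading p e opp) ` ({..<2} \<times> UNIV \<times> UNIV),
     alphabet = {..3}, init = Start, accepting = {Halted}, transition = reader_step \<rparr>"

lemma wf_reader_automaton: "wf_automaton reader_automaton"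
proof -
  have "q' \<in> states reader_automaton"
    if "q \<in> states reader_automaton" "reader_step q a Z = Some (q', ops)" for q a Z q' ops
    using that by (cases q) (auto simp: reader_automaton_def image_iff split: if_splits)
  then show ?thesis
    unfolding wf_automaton_def by (auto simp: reader_automaton_def)
qed

lemma reader_Cons:
  "accepts_from reader_automaton (q, c) (a # w) \<longleftrightarrow>
     (case reader_step q a {i. i < 2 \<and> c i = 0} of
        None \<Rightarrow> False
      | Some (q', ops) \<Rightarrow> accepts_from reader_automaton (q', \<lambda>i. apply_op (ops i) (c i)) w)"
  unfolding accepts_from_Cons by (simp add: reader_automaton_def[THEN arg_cong, of counters]
      reader_automaton_def[THEN arg_cong, of transition])

lemma reader_Nil:
  "accepts_from reader_automaton (q, c) [] \<longleftrightarrow> q = Halted \<and> (\<forall>i < 2. c i = 0)"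
  by (simp add: accepts_from_Nil reader_automaton_def)

lemma reader_Halted: "accepts_from reader_automaton (Halted, \<lambda>_. 0) w \<longleftrightarrow> w = []"
  by (cases w) (simp_all add: reader_Cons reader_Nil)

lemma encode_Cons: "encode (x # r) = of_bool (snd x) # replicate (fst x - 1) 2 @ encode r"
  by (simp add: encode_def block_def)

lemma encode_Nil: "encode [] = [3]"
  by (simp add: encode_def)

text \<open>
  Parsing an encoding from the left: its first letter determines whether the word is empty.
\<close>

lemma encode_eq_Cons_cases:
  assumes "r \<in> group_words {1..}"
  shows "encode r = a # w \<longleftrightarrow> (r = [] \<and> a = 3 \<and> w = []) \<or>
     (\<exists>n e s. r = (Suc n, e) # s \<and> s \<in> group_words {1..} \<and> a = of_bool e \<and> w = replicate n 2 @ encode s)"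
proof (cases r)
  case Nil
  then show ?thesis by (auto simp: encode_Nil)
next
  case (Cons x s)
  obtain b e where x: "x = (b, e)" by force
  have "b \<ge> 1" "s \<in> group_words {1..}"
    using assms by (auto simp: Cons x group_words_def)
  then obtain n where "b = Suc n"
    by (cases b) auto
  then show ?thesis
    using \<open>s \<in> _\<close> by (auto simp: Cons x encode_Cons)
qed

lemma encode_eq_sign_Cons:
  assumes "r \<in> group_words {1..}"
  shows "encode r = of_bool e # w \<longleftrightarrow>
     (\<exists>n s. r = (Suc n, e) # s \<and> s \<in> group_words {1..} \<and> w = replicate n 2 @ encode s)"
proof -
  have "of_bool e \<noteq> (3 :: nat)"
    by (cases e) auto
  then show ?thesis
    using encode_eq_Cons_cases[OF assms, of "of_bool e" w] by auto
qed

text \<open>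
  The invariant of the automaton. The previous letter is \<open>(b, d)\<close>, and \<open>(a, e)\<close> is the part of the current
  letter that has been read, whose index may still grow by the \<open>n\<close> ticks at the beginning of the input.
  Stating it for the remaining input \<open>w\<close> lets each input letter correspond to one use of
  the induction hypothesis: a tick changes \<open>a\<close>, a sign makes the current letter the previous one.
\<close>

lemma reader_Reading:
  assumes "p < 2" "c p = int a - 1" "c (1 - p) = int b - int a" "w \<in> lists {..3}"
  shows "accepts_from reader_automaton (Reading p e (d \<noteq> e), c) w \<longleftrightarrow>
    (\<exists>n r. r \<in> group_words {1..} \<and> w = replicate n 2 @ encode r \<and> reduced ((b, d) # (a + n, e) # r))"
  using assms
proof (induction w arbitrary: p a b c d e)
  case Nil
  then show ?case
    by (auto simp: reader_Nil encode_def)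
next
  case (Cons l w)
  have p: "p = 0 \<or> p = 1" and w: "w \<in> lists {..3}"
    using Cons.prems by auto
  consider "l = 2" | "l = 3" | f where "l = of_bool f"
  proof -
    have "l = of_bool True \<or> l = of_bool False \<or> l = 2 \<or> l = 3"
      using Cons.prems(4) by auto
    then show ?thesis using that by blast
  qed
  then show ?case
  proof cases
    case 1
    have IH: "accepts_from reader_automaton
        (Reading p e (d \<noteq> e), \<lambda>i. apply_op (if i = p then Add 1 else Add (- 1)) (c i)) w \<longleftrightarrow>
      (\<exists>n r. r \<in> group_words {1..} \<and> w = replicate n 2 @ encode r \<and> reduced ((b, d) # (Suc a + n, e) # r))"
      using Cons.prems p by (intro Cons.IH) auto
    have no: "encode r \<noteq> l # w" if "r \<in> group_words {1..}" for r
      using that 1 by (auto simp: encode_eq_Cons_cases of_bool_def)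
    have "(\<exists>n r. r \<in> group_words {1..} \<and> l # w = replicate n 2 @ encode r \<and> reduced ((b, d) # (a + n, e) # r)) \<longleftrightarrow>
      (\<exists>n r. r \<in> group_words {1..} \<and> l # w = replicate (Suc n) 2 @ encode r \<and> reduced ((b, d) # (a + Suc n, e) # r))"
      (is "(\<exists>n. ?Q n) \<longleftrightarrow> _")
    proof -
      have "\<not> ?Q 0" using no by force
      then show ?thesis by (metis not0_implies_Suc)
    qed
    then show ?thesis
      using 1 IH by (simp add: reader_Cons)
  next
    case 2
    have "(\<exists>n r. r \<in> group_words {1..} \<and> l # w = replicate n 2 @ encode r \<and> reduced ((b, d) # (a + n, e) # r)) \<longleftrightarrow>
      w = [] \<and> reduced ((b, d) # (a, e) # [])" (is "?lhs \<longleftrightarrow> ?rhs")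
    proof
      assume ?lhs
      then obtain n r where r: "r \<in> group_words {1..}" "3 # w = replicate n 2 @ encode r"
        "reduced ((b, d) # (a + n, e) # r)" using 2 by auto
      then have "n = 0" by (cases n) auto
      then show ?rhs
        using r encode_eq_Cons_cases[OF r(1), of 3 w] by (auto simp: of_bool_def split: if_splits)
    next
      assume ?rhs
      then show ?lhs
        using 2 by (intro exI[of _ 0] exI[of _ "[]"]) (auto simp: encode_Nil group_words_def)
    qed
    then show ?thesis
      using 2 p Cons.prems
      by (auto simp: reader_Cons reader_Halted reduced_Cons_Cons cancels_def reduced_def)
  next
    case 3
    have "accepts_from reader_automaton
        (Reading (1 - p) f (e \<noteq> f), \<lambda>i. apply_op (if i = p then Add 0 else Reset) (c i)) w \<longleftrightarrow>
      (\<exists>n r. r \<in> group_words {1..} \<and> w = replicate n 2 @ encode r \<and> reduced ((a, e) # (1 + n, f) # r))"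
      using Cons.prems p by (intro Cons.IH) auto
    moreover have "(\<exists>n r. r \<in> group_words {1..} \<and> l # w = replicate n 2 @ encode r \<and> reduced ((b, d) # (a + n, e) # r)) \<longleftrightarrow>
      \<not> cancels (b, d) (a, e) \<and>
      (\<exists>n r. r \<in> group_words {1..} \<and> w = replicate n 2 @ encode r \<and> reduced ((a, e) # (1 + n, f) # r))" (is "?lhs \<longleftrightarrow> ?rhs")
    proof
      assume ?lhs
      then obtain n r where r: "r \<in> group_words {1..}" "of_bool f # w = replicate n 2 @ encode r"
        "reduced ((b, d) # (a + n, e) # r)" using 3 by auto
      then have "n = 0" by (cases n) (auto simp: of_bool_def split: if_splits)
      then show ?rhs
        using r(2,3) encode_eq_sign_Cons[OF r(1), of f w]
        by (fastforce simp: reduced_Cons_Cons)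
    next
      assume ?rhs
      then obtain n r where "r \<in> group_words {1..}" "w = replicate n 2 @ encode r"
         "reduced ((a, e) # (1 + n, f) # r)" "\<not> cancels (b, d) (a, e)" by auto
      then show ?lhs
        using 3 by (intro exI[of _ 0] exI[of _ "(1 + n, f) # r"])
           (auto simp: encode_Cons group_words_def reduced_Cons_Cons)
    qed
    moreover have "accepts_from reader_automaton (Reading p e (d \<noteq> e), c) (l # w) \<longleftrightarrow>
      \<not> (d \<noteq> e \<and> c (1 - p) = 0) \<and> accepts_from reader_automaton
        (Reading (1 - p) f (e \<noteq> f), \<lambda>i. apply_op (if i = p then Add 0 else Reset) (c i)) w"
      using p by (cases f) (auto simp: 3 reader_Cons)
    moreover have "cancels (b, d) (a, e) \<longleftrightarrow> d \<noteq> e \<and> c (1 - p) = 0"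
      using Cons.prems(3) by (auto simp: cancels_def)
    ultimately show ?thesis
      by (simp only:)
  qed
qed

lemma encode_in_lists: "encode r \<in> lists {..3}"
  by (induction r) (auto simp: encode_Nil encode_Cons)

text \<open>
  The first letter has no predecessor. In the invariant \<open>(1, e)\<close> serves as one: it has the sign of the
  first letter and so cannot cancel it, and its index fits the initial counter values.
\<close>

lemma language_reader: "language reader_automaton = encode ` reduced_words {1..}"
proof -
  have "accepts_from reader_automaton (Start, \<lambda>_. 0) w \<longleftrightarrow> w \<in> encode ` reduced_words {1..}"
    if "w \<in> lists {..3}" for w
  proof (cases w)
    case Nil
    then show ?thesis by (auto simp: reader_Nil encode_def)
  next
    case (Cons l w')
    have l: "l = of_bool True \<or> l = of_bool False \<or> l = 2 \<or> l = 3" and w': "w' \<in> lists {..3}"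
      using that by (auto simp: Cons)
    have R: "w \<in> encode ` reduced_words {1..} \<longleftrightarrow>
      (l = 3 \<and> w' = []) \<or> (\<exists>n e s. l = of_bool e \<and> s \<in> group_words {1..} \<and>
         w' = replicate n 2 @ encode s \<and> reduced ((1, e) # (1 + n, e) # s))" (is "_ \<longleftrightarrow> ?R")
    proof
      assume "w \<in> encode ` reduced_words {1..}"
      then obtain r where r: "r \<in> group_words {1..}" "reduced r" "encode r = l # w'"
        by (auto simp: reduced_words_def Cons)
      have "reduced ((1, e) # (1 + n, e) # s)" if "r = (Suc n, e) # s" for n e s
        using that r(2) by (simp add: reduced_Cons_Cons cancels_def)
      with r(3) show ?R
        unfolding encode_eq_Cons_cases[OF r(1)] by blast
    next
      assume ?R
      then show "w \<in> encode ` reduced_words {1..}"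
      proof
        assume "l = 3 \<and> w' = []"
        then have "w = encode []" by (simp add: Cons encode_Nil)
        then show ?thesis by (auto simp: reduced_words_def group_words_def reduced_def)
      next
        assume "\<exists>n e s. l = of_bool e \<and> s \<in> group_words {1..} \<and>
         w' = replicate n 2 @ encode s \<and> reduced ((1, e) # (1 + n, e) # s)"
        then obtain n e s where "l = of_bool e" "s \<in> group_words {1..}"
          "w' = replicate n 2 @ encode s" "reduced ((1, e) # (1 + n, e) # s)" by blast
        then have "w = encode ((1 + n, e) # s)" "(1 + n, e) # s \<in> reduced_words {1..}"
          by (auto simp: Cons encode_Cons reduced_words_def group_words_def reduced_Cons_Cons)
        then show ?thesis by blast
      qed
    qed
    have start: "accepts_from reader_automaton (Reading 0 f False, \<lambda>_. 0) w' \<longleftrightarrow>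
      (\<exists>n s. s \<in> group_words {1..} \<and>
         w' = replicate n 2 @ encode s \<and> reduced ((1, f) # (1 + n, f) # s))" for f
      using reader_Reading[of 0 "\<lambda>_. 0" 1 1 w' f f] w' by simp
    have "?R \<longleftrightarrow> (l = 3 \<and> w' = []) \<or>
        (\<exists>f. l = of_bool f \<and> accepts_from reader_automaton (Reading 0 f False, \<lambda>_. 0) w')"
      unfolding start by blast
    also have "\<dots> \<longleftrightarrow> accepts_from reader_automaton (Start, \<lambda>_. 0) w"
      using l by (elim disjE) (simp_all add: ex_bool_eq Cons reader_Cons reader_Halted)
    finally show ?thesis
      using R by blast
  qed
  then show ?thesis
    using encode_in_lists by (auto simp: language_eq reader_automaton_def[THEN arg_cong, of alphabet]
       reader_automaton_def[THEN arg_cong, of init])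
qed

lemma encode_reduced_words_in_counter_languages:
  "encode ` reduced_words {1..} \<in> counter_languages 2"
  using language_in_counter_languages[OF wf_reader_automaton] language_reader
  by (simp add: reader_automaton_def[THEN arg_cong, of counters])

section \<open>Reduced words are normal forms of a free group\<close>

definition flip :: "'a \<times> bool \<Rightarrow> 'a \<times> bool" where
  "flip x = (fst x, \<not> snd x)"

text \<open>
  Right multiplication of a reduced word by a letter, followed by reduction. Folding it over a word
  computes the reduced word of its class; uniqueness of reduced words follows because this
  computation is invariant under cancellation.
\<close>

definition push :: "('a \<times> bool) list \<Rightarrow> 'a \<times> bool \<Rightarrow> ('a \<times> bool) list" where
  "push r x = (if r \<noteq> [] \<and> cancels (last r) x then butlast r else r @ [x])"

abbreviation word_class :: "'a set \<Rightarrow> ('a \<times> bool) list \<Rightarrow> ('a \<times> bool) list set" where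
  "word_class S w \<equiv> free_equiv S `` {w}"

lemma cancels_iff_flip: "cancels y x \<longleftrightarrow> y = flip x"
  by (cases x; cases y) (auto simp: cancels_def flip_def)

lemma flip_flip: "flip (flip x) = x"
  by (simp add: flip_def)

lemma reduced_append1:
  "reduced (r @ [x]) \<longleftrightarrow> reduced r \<and> (r = [] \<or> \<not> cancels (last r) x)"
  by (auto simp: reduced_def successively_append_iff)

lemma push_flip: "push (r @ [flip x]) x = r"
  by (simp add: push_def cancels_iff_flip)

lemma push_cases:
  obtains "push r x = r @ [x]" "\<And>S. r \<in> reduced_words S \<Longrightarrow> x \<in> S \<times> UNIV \<Longrightarrow> r @ [x] \<in> reduced_words S"
  | s where "r = s @ [flip x]" "push r x = s"
proof (cases "r \<noteq> [] \<and> cancels (last r) x")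
  case True
  then have "r = butlast r @ [flip x]"
    by (metis append_butlast_last_id cancels_iff_flip)
  then show thesis using that(2) push_flip by metis
next
  case False
  then show thesis
    using that(1) by (auto simp: push_def reduced_words_def reduced_append1 group_words_def)
qed

lemma push_in_reduced_words:
  assumes "r \<in> reduced_words S" "x \<in> S \<times> UNIV"
  shows "push r x \<in> reduced_words S"
  using assms by (cases rule: push_cases[of r x])
    (auto simp: reduced_words_def reduced_append1 group_words_def)

text \<open>
  Letters act on reduced words by permutations, and mutually inverse letters by mutually inverse ones.
  Reducedness is essential in the second case: after \<open>x\<close> has deleted the last letter of \<open>r\<close>, its
  inverse must be appended, and not cancel the letter before.
\<close>

lemma push_push_flip:
  assumes "reduced r"
  shows "push (push r x) (flip x) = r"
proof (cases rule: push_cases[of r x])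
  case 1
  then show ?thesis
    using push_flip[of r "flip x"] by (simp add: flip_flip)
next
  case (2 s)
  then show ?thesis
    using assms by (auto simp: push_def reduced_append1)
qed

lemma foldl_push_in_reduced_words:
  assumes "w \<in> group_words S" "r \<in> reduced_words S"
  shows "foldl push r w \<in> reduced_words S"
  using assms by (induction w arbitrary: r) (auto simp: group_words_def intro!: push_in_reduced_words)

lemma Nil_in_reduced_words: "[] \<in> reduced_words S"
  by (simp add: reduced_words_def group_words_def reduced_def)

lemma foldl_push_of_reduced: "reduced w \<Longrightarrow> foldl push [] w = w"
  by (induction w rule: rev_induct) (auto simp: reduced_append1 push_def)

lemma foldl_push_cancellation:
  assumes "(p, q) \<in> cancellation S"
  shows "foldl push [] p = foldl push [] q"
proof -
  obtain u v a e where "p = u @ [(a, e), flip (a, e)] @ v" "q = u @ v" "u \<in> group_words S"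
    using assms by (auto simp: cancellation_def flip_def)
  moreover have "reduced (foldl push [] u)"
    using foldl_push_in_reduced_words[OF \<open>u \<in> group_words S\<close> Nil_in_reduced_words]
    by (simp add: reduced_words_def)
  ultimately show ?thesis
    by (simp add: push_push_flip)
qed

lemma foldl_push_free_equiv:
  assumes "(p, q) \<in> free_equiv S"
  shows "foldl push [] p = foldl push [] q"
proof -
  have "(p, q) \<in> (cancellation S \<union> (cancellation S)\<inverse>)\<^sup>*"
    using assms by (simp add: free_equiv_def)
  then show ?thesis
    by induction (auto dest: foldl_push_cancellation)
qed

lemma append1_free_equiv_push:
  assumes "r \<in> group_words S" "x \<in> S \<times> UNIV"
  shows "(r @ [x], push r x) \<in> free_equiv S"
proof (cases rule: push_cases[of r x])
  case 1
  then show ?thesis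
    using assms by (auto simp: free_equiv_def group_words_def)
next
  case (2 s)
  obtain a e where x: "x = (a, e)" by force
  have "(s @ [(a, \<not> e), (a, \<not> \<not> e)] @ [], s @ []) \<in> cancellation S"
    unfolding cancellation_def using assms 2 x
    by (intro CollectI exI[of _ s] exI[of _ "[]"] exI[of _ a] exI[of _ "\<not> e"]) (simp add: group_words_def)
  then show ?thesis
    using assms 2 by (auto simp: free_equiv_def group_words_def x flip_def)
qed

lemma word_class_push:
  assumes "r \<in> group_words S" "x \<in> S \<times> UNIV"
  shows "word_class S (push r x) = word_class S r \<otimes>\<^bsub>free_group S\<^esub> word_class S [x]"
proof -
  have "[x] \<in> group_words S"
    using assms by (simp add: group_words_def)
  then show ?thesis
    using assms equiv_class_eq[OF equiv_free_equiv append1_free_equiv_push[OF assms]]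
    by (simp add: free_group_mult_class)
qed

lemma word_class_foldl_push:
  assumes "w \<in> group_words S"
  shows "word_class S (foldl push [] w) = word_class S w"
  using assms
proof (induction w rule: rev_induct)
  case (snoc x w)
  then have w: "w \<in> group_words S" and x: "x \<in> S \<times> UNIV" "[x] \<in> group_words S"
    by (auto simp: group_words_def)
  have "foldl push [] w \<in> group_words S"
    using foldl_push_in_reduced_words[OF w Nil_in_reduced_words] by (simp add: reduced_words_def)
  then show ?case
    using snoc.IH w x by (simp add: word_class_push free_group_mult_class)
qed simp

lemma bij_betw_word_class:
  "bij_betw (word_class S) (reduced_words S) (carrier (free_group S))"
proof (rule bij_betwI')
  fix r s assume r: "r \<in> reduced_words S" and s: "s \<in> reduced_words S"
  show "word_class S r = word_class S s \<longleftrightarrow> r = s"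
  proof
    assume "word_class S r = word_class S s"
    then have "(r, s) \<in> free_equiv S"
      using eq_equiv_class[OF _ equiv_free_equiv] s by (auto simp: reduced_words_def)
    then show "r = s"
      using r s foldl_push_free_equiv by (fastforce simp: reduced_words_def foldl_push_of_reduced)
  qed simp
next
  fix r assume "r \<in> reduced_words S"
  then show "word_class S r \<in> carrier (free_group S)"
    by (auto simp: free_group_def reduced_words_def quotientI)
next
  fix g assume "g \<in> carrier (free_group S)"
  then obtain w where "w \<in> group_words S" "g = word_class S w"
    by (auto simp: free_group_def quotient_def)
  then show "\<exists>r \<in> reduced_words S. g = word_class S r"
    using foldl_push_in_reduced_words[OF _ Nil_in_reduced_words] word_class_foldl_push by metis
qed

lemma inv_word_class:
  assumes "x \<in> S \<times> UNIV"
  shows "inv\<^bsub>free_group S\<^esub> (word_class S [x]) = word_class S [flip x]"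
proof (rule group.inv_equality[OF group_free_group])
  have gw: "[x] \<in> group_words S" "[flip x] \<in> group_words S"
    using assms by (auto simp: group_words_def flip_def)
  then show "word_class S [x] \<in> carrier (free_group S)" "word_class S [flip x] \<in> carrier (free_group S)"
    by (auto simp: free_group_def quotientI)
  show "word_class S [flip x] \<otimes>\<^bsub>free_group S\<^esub> word_class S [x] = \<one>\<^bsub>free_group S\<^esub>"
    using word_class_push[OF gw(2) assms] push_flip[of "[]" x] by (simp add: free_group_def)
qed

lemma generate_letters:
  "generate (free_group S) ((\<lambda>x. word_class S [x]) ` (S \<times> UNIV)) = carrier (free_group S)"
    (is "generate ?G ?X = _")
proof
  have "?X \<subseteq> carrier ?G"
    by (auto simp: free_group_def group_words_def intro!: quotientI)
  then show "generate ?G ?X \<subseteq> carrier ?G"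
    using group.generate_incl[OF group_free_group] by blast
  have "word_class S w \<in> generate ?G ?X" if "w \<in> group_words S" for w
    using that
  proof (induction w rule: rev_induct)
    case Nil
    then show ?case
      using generate.one[of ?G ?X] by (simp add: free_group_def)
  next
    case (snoc x w)
    then have "w \<in> group_words S" "[x] \<in> group_words S" "x \<in> S \<times> UNIV"
      by (auto simp: group_words_def)
    then show ?case
      using snoc.IH free_group_mult_class[of w S "[x]"] generate.eng generate.incl
      by (metis (no_types, lifting) imageI)
  qed
  then show "carrier ?G \<subseteq> generate ?G ?X"
    by (auto simp: free_group_def quotient_def)
qed

section \<open>Convolutions of a word and its product with a generator\<close>

text \<open>
  Blocks can be split off from the right, as the last letter other than a tick is the sign of the last
  block. This makes the encoding injective, and it identifies the last letter of an encoded word.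
\<close>

lemma append_Cons_replicate_eq:
  assumes "A @ c # replicate m t = B @ d # replicate n t" "c \<noteq> t" "d \<noteq> t"
  shows "A = B \<and> c = d \<and> m = n"
  using assms
proof (induction m arbitrary: n)
  case 0
  then show ?case
    by (cases n) (auto simp: replicate_append_same[symmetric] simp flip: append_Cons append_assoc)
next
  case (Suc m)
  then show ?case
    by (cases n) (auto simp: replicate_append_same[symmetric] simp flip: append_Cons append_assoc)
qed

lemma append_block_eq:
  assumes "A @ block y = B @ block z" "fst y \<ge> 1" "fst z \<ge> 1"
  shows "A = B \<and> y = z"
proof -
  have "of_bool b \<noteq> (2 :: nat)" for b
    by (cases b) auto
  then have "A = B \<and> of_bool (snd y) = (of_bool (snd z) :: nat) \<and> fst y - 1 = fst z - 1"
    using assms(1) append_Cons_replicate_eq unfolding block_def by metis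
  then show ?thesis
    using assms(2,3) by (cases y; cases z) (simp add: eq_diff_iff of_bool_eq_iff)
qed

lemma append_block_eq_encode:
  assumes "A @ block y @ [3] = encode s" "fst y \<ge> 1" "s \<in> group_words {1..}"
  obtains r where "s = r @ [y]" "A = concat (map block r)"
proof (cases s rule: rev_cases)
  case Nil
  then show thesis using assms by (simp add: encode_def block_def)
next
  case (snoc r z)
  have "A @ block y = concat (map block r) @ block z"
    using assms(1) by (simp add: encode_def snoc flip: append_assoc)
  moreover have "fst z \<ge> 1"
    using assms(3) by (auto simp: snoc group_words_def)
  ultimately show thesis
    using that append_block_eq assms(2) snoc by blast
qed

lemma encode_append1: "encode (r @ [x]) = concat (map block r) @ block x @ [3]"
  by (simp add: encode_def)

lemma inj_on_encode: "inj_on encode (group_words {1..})"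
proof (rule inj_onI)
  fix r s assume "r \<in> group_words {1..}" "s \<in> group_words {1..}" "encode r = encode s"
  then show "r = s"
  proof (induction r arbitrary: s rule: rev_induct)
    case Nil
    then show ?case
      using append_block_eq_encode by (cases s rule: rev_cases) (auto simp: encode_def block_def)
  next
    case (snoc x r)
    have "fst x \<ge> 1" "r \<in> group_words {1..}"
      using snoc.prems(1) by (auto simp: group_words_def)
    then obtain r' where s: "s = r' @ [x]" "concat (map block r) = concat (map block r')"
      using append_block_eq_encode[OF _ _ snoc.prems(2)] snoc.prems(3) unfolding encode_append1 by metis
    then have "r = r'"
      using snoc.IH[of r'] snoc.prems(2) \<open>r \<in> _\<close> by (auto simp: encode_def group_words_def)
    then show ?case
      using s by simp
  qed
qed

abbreviation diagonal :: "'a list \<Rightarrow> ('a option \<times> 'a option) list" where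
  "diagonal \<equiv> map (\<lambda>a. (Some a, Some a))"

lemma convolution_Cons: "convolution (a # u) (b # v) = (Some a, Some b) # convolution u v"
proof -
  have "[0..<Suc n] = 0 # map Suc [0..<n]" for n
    by (subst upt_conv_Cons) (simp_all add: map_Suc_upt del: upt_Suc)
  then show ?thesis
    by (simp add: convolution_def o_def del: upt_Suc)
qed

lemma convolution_append: "convolution (p @ u) (p @ v) = diagonal p @ convolution u v"
  by (induction p) (simp_all add: convolution_Cons)

lemma convolution_Nil_left: "convolution [] v = map (\<lambda>b. (None, Some b)) v"
  by (rule nth_equalityI) (auto simp: convolution_def)

lemma convolution_Nil_right: "convolution u [] = map (\<lambda>a. (Some a, None)) u"
  by (rule nth_equalityI) (auto simp: convolution_def)

definition orient :: "bool \<Rightarrow> 'p \<Rightarrow> 'p \<Rightarrow> 'p \<times> 'p" where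
  "orient b p q = (if b then (p, q) else (q, p))"

text \<open>
  The two ways in which the convolution can continue after the diagonal part, where the letter
  that multiplies is \<open>(Suc n, e)\<close>. If \<open>b\<close> holds, this letter is appended and the second component is the
  longer one; otherwise its inverse, of sign \<open>\<not> e\<close>, is deleted and the first component is the longer
  one. In both cases the longer component has the sign \<open>e = b\<close>.
\<close>

definition tail :: "bool \<Rightarrow> nat \<Rightarrow> bool \<Rightarrow> (nat option \<times> nat option) list" where
  "tail e n b = orient b (Some 3) (Some (of_bool (e = b))) #
     replicate n (orient b None (Some 2)) @ [orient b None (Some 3)]"

lemma convolution_append_letter:
  "convolution (encode r) (encode (r @ [(Suc n, e)])) = diagonal (concat (map block r)) @ tail e n True"
  by (simp add: encode_def block_def convolution_append convolution_Cons convolution_Nil_left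
      tail_def orient_def)

lemma convolution_delete_letter:
  "convolution (encode (r @ [(Suc n, \<not> e)])) (encode r) = diagonal (concat (map block r)) @ tail e n False"
  by (simp add: encode_def block_def convolution_append convolution_Cons convolution_Nil_right
      tail_def orient_def)

text \<open>
  The letter of the longer component: the shorter one has ended as soon as it shows its end marker
  or the padding symbol. The value at \<open>(None, None)\<close> is arbitrary.
\<close>

fun longer :: "nat option \<times> nat option \<Rightarrow> nat" where
  "longer (Some l, q) = (if l = 3 then (case q of None \<Rightarrow> 3 | Some l' \<Rightarrow> l') else l)"
| "longer (None, q) = (case q of None \<Rightarrow> 3 | Some l' \<Rightarrow> l')"

lemma map_longer: "map longer (diagonal p @ tail e n b) = p @ block (Suc n, e = b) @ [3]"
proof -
  have "of_bool c \<noteq> (3 :: nat)" for c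
    by (cases c) auto
  then show ?thesis
    by (auto simp: tail_def orient_def block_def o_def intro!: map_idI)
qed

datatype tail_state = Common | Tail bool nat | Done

text \<open>
  The state \<open>Tail b k\<close> expects \<open>k\<close> more ticks; as \<open>k\<close> never exceeds \<open>n\<close>, finitely many states suffice.
  The diagonal part is left at the first column with two different components, so the automaton is
  deterministic.
\<close>

fun tail_step ::
  "bool \<Rightarrow> nat \<Rightarrow> tail_state \<Rightarrow> nat option \<times> nat option \<Rightarrow> tail_state option" where
  "tail_step e n Common z =
     (if fst z = snd z \<and> fst z \<noteq> None then Some Common
      else if z = orient True (Some 3) (Some (of_bool e)) then Some (Tail True n)
      else if z = orient False (Some 3) (Some (of_bool (\<not> e))) then Some (Tail False n)
      else None)"
| "tail_step e n (Tail b (Suc k)) z = (if z = orient b None (Some 2) then Some (Tail b k) else None)"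
| "tail_step e n (Tail b 0) z = (if z = orient b None (Some 3) then Some Done else None)"
| "tail_step e n Done z = None"

definition tail_automaton ::
  "bool \<Rightarrow> nat \<Rightarrow> (tail_state, nat option \<times> nat option) counter_automaton" where
  "tail_automaton e n = \<lparr> counters = 0,
     states = {Common, Done} \<union> (\<lambda>(b, k). Tail b k) ` (UNIV \<times> {..n}),
     alphabet = insert None (Some ` {..3}) \<times> insert None (Some ` {..3}),
     init = Common, accepting = {Done},
     transition = (\<lambda>q z Z. map_option (\<lambda>q'. (q', \<lambda>_. Reset)) (tail_step e n q z)) \<rparr>"

lemma wf_tail_automaton: "wf_automaton (tail_automaton e n)"
proof -
  have "q' \<in> states (tail_automaton e n)"
    if "q \<in> states (tail_automaton e n)" "tail_step e n q z = Some q'" for q z q'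
    using that(2,1) by (cases "(e, n, q, z)" rule: tail_step.cases)
      (auto simp: tail_automaton_def split: if_splits)
  then show ?thesis
    unfolding wf_automaton_def by (auto simp: tail_automaton_def)
qed

lemma tail_automaton_Nil: "accepts_from (tail_automaton e n) (q, c) [] \<longleftrightarrow> q = Done"
  by (simp add: accepts_from_Nil tail_automaton_def)

lemma tail_automaton_Cons:
  "accepts_from (tail_automaton e n) (q, c) (z # w) \<longleftrightarrow>
     (case tail_step e n q z of
        None \<Rightarrow> False | Some q' \<Rightarrow> accepts_from (tail_automaton e n) (q', \<lambda>_. 0) w)"
  unfolding accepts_from_Cons
  by (simp add: tail_automaton_def[THEN arg_cong, of transition] split: option.split)

lemma tail_automaton_Done: "accepts_from (tail_automaton e n) (Done, c) w \<longleftrightarrow> w = []"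
  by (cases w) (simp_all add: tail_automaton_Nil tail_automaton_Cons)

lemma tail_automaton_Tail:
  "accepts_from (tail_automaton e n) (Tail b k, c) w \<longleftrightarrow>
     w = replicate k (orient b None (Some 2)) @ [orient b None (Some 3)]"
proof (induction k arbitrary: w c)
  case 0
  then show ?case
    by (cases w) (simp_all add: tail_automaton_Nil tail_automaton_Cons tail_automaton_Done)
next
  case (Suc k)
  then show ?case
    by (cases w) (simp_all add: tail_automaton_Nil tail_automaton_Cons)
qed

lemma tail_automaton_Common:
  "accepts_from (tail_automaton e n) (Common, c) w \<longleftrightarrow> (\<exists>p b. w = diagonal p @ tail e n b)"
proof (induction w arbitrary: c)
  case Nil
  then show ?case
    by (simp add: tail_automaton_Nil tail_def)
next
  case (Cons z w)
  have off: "orient b (Some 3) (Some (of_bool d)) \<noteq> (Some l, Some l)" for b d and l :: nat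
    by (cases d) (auto simp: orient_def)
  have split: "(\<exists>p b. z # w = diagonal p @ tail e n b) \<longleftrightarrow>
    (\<exists>b. z # w = tail e n b) \<or> (\<exists>l p b. z = (Some l, Some l) \<and> w = diagonal p @ tail e n b)"
    (is "?lhs \<longleftrightarrow> ?rhs")
  proof
    assume ?lhs
    then obtain p b where "z # w = diagonal p @ tail e n b" by blast
    then show ?rhs by (cases p) auto
  next
    assume ?rhs
    then show ?lhs
    proof (elim disjE exE conjE)
      fix b assume "z # w = tail e n b"
      then show ?lhs by (intro exI[of _ "[]"] exI[of _ b]) simp
    next
      fix l p b assume "z = (Some l, Some l)" "w = diagonal p @ tail e n b"
      then show ?lhs by (intro exI[of _ "l # p"] exI[of _ b]) simp
    qed
  qed
  have tl: "z # w = tail e n b \<longleftrightarrow> z = orient b (Some 3) (Some (of_bool (e = b))) \<and>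
      accepts_from (tail_automaton e n) (Tail b n, \<lambda>_. 0) w" for b
    by (simp add: tail_def tail_automaton_Tail)
  show ?case
  proof (cases "\<exists>l. z = (Some l, Some l)")
    case True
    then obtain l where z: "z = (Some l, Some l)" by blast
    have "tail_step e n Common z = Some Common"
      by (simp add: z)
    then have "accepts_from (tail_automaton e n) (Common, c) (z # w) \<longleftrightarrow>
        accepts_from (tail_automaton e n) (Common, \<lambda>_. 0) w"
      by (simp add: tail_automaton_Cons)
    moreover have "z \<noteq> orient b (Some 3) (Some (of_bool d))" for b d
      using off z by metis
    ultimately show ?thesis
      unfolding split tl using z Cons.IH by blast
  next
    case False
    then have "\<not> (fst z = snd z \<and> fst z \<noteq> None)"
      by (cases z) auto
    moreover have "orient True (Some 3) (Some (of_bool e)) \<noteq> orient False (Some (3 :: nat)) (Some (of_bool (\<not> e)))"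
      by (cases e) (auto simp: orient_def)
    ultimately show ?thesis
      unfolding split tl using False by (auto simp: tail_automaton_Cons ex_bool_eq)
  qed
qed

lemma convolution_in_lists:
  assumes "u \<in> lists A" "v \<in> lists A"
  shows "convolution u v \<in> lists (insert None (Some ` A) \<times> insert None (Some ` A))"
  using assms by (auto simp: convolution_def in_lists_conv_set)

text \<open>
  A convolution of the right shape whose longer component encodes the reduced word \<open>s\<close> must come from a
  multiplication by \<open>(a, e)\<close>: its tail forces the last letter of \<open>s\<close> to be \<open>(a, e)\<close> or
  its inverse.
\<close>

lemma push_language:
  assumes "a \<ge> 1"
  shows "{convolution (encode r) (encode (push r (a, e))) | r. r \<in> reduced_words {1..}}
     \<in> counter_languages 2" (is "?K \<in> _")
proof -
  obtain n where a: "a = Suc n"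
    using assms by (cases a) auto
  let ?x = "(Suc n, e)" and ?L = "encode ` reduced_words {1..}"
  have x: "?x \<in> {1..} \<times> UNIV" by simp
  have "?K = {w \<in> language (tail_automaton e n). map longer w \<in> ?L}" (is "_ = ?K'")
  proof (rule subset_antisym; rule subsetI)
    fix w assume "w \<in> ?K"
    then obtain r where r: "r \<in> reduced_words {1..}" and w: "w = convolution (encode r) (encode (push r ?x))"
      by (auto simp: a)
    have "\<exists>p b. w = diagonal p @ tail e n b \<and> p @ block (Suc n, e = b) @ [3] \<in> ?L"
    proof (cases rule: push_cases[of r ?x])
      case 1
      then show ?thesis
        using r x w by (intro exI[of _ "concat (map block r)"] exI[of _ True])
          (auto simp: convolution_append_letter simp flip: encode_append1)
    next
      case (2 s)
      then show ?thesis
        using r w by (intro exI[of _ "concat (map block s)"] exI[of _ False])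
          (auto simp: convolution_delete_letter flip_def simp flip: encode_append1)
    qed
    moreover have "w \<in> lists (alphabet (tail_automaton e n))"
      unfolding w using convolution_in_lists[OF encode_in_lists encode_in_lists]
      by (simp add: tail_automaton_def)
    ultimately show "w \<in> ?K'"
      using map_longer by (auto simp: language_eq tail_automaton_Common
          tail_automaton_def[THEN arg_cong, of init])
  next
    fix w assume "w \<in> ?K'"
    then obtain p b where w: "w = diagonal p @ tail e n b" and "p @ block (Suc n, e = b) @ [3] \<in> ?L"
      using map_longer by (auto simp: language_eq tail_automaton_Common
          tail_automaton_def[THEN arg_cong, of init])
    then obtain s where s: "s \<in> reduced_words {1..}" "p @ block (Suc n, e = b) @ [3] = encode s"
      by auto
    then obtain r where r: "s = r @ [(Suc n, e = b)]" "p = concat (map block r)"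
      using append_block_eq_encode[of p "(Suc n, e = b)" s] by (auto simp: reduced_words_def)
    show "w \<in> ?K"
    proof (cases b)
      case True
      then have "reduced (r @ [?x])" "r \<in> reduced_words {1..}"
        using s r by (auto simp: reduced_words_def reduced_append1 group_words_def)
      moreover have "push r ?x = r @ [?x]"
        using \<open>reduced (r @ [?x])\<close> by (auto simp: push_def reduced_append1)
      moreover have "w = convolution (encode r) (encode (r @ [?x]))"
        using True w r by (simp add: convolution_append_letter)
      ultimately show ?thesis
        by (auto simp: a intro!: exI[of _ r])
    next
      case False
      then have "s = r @ [flip ?x]" "w = convolution (encode s) (encode r)"
        using w r by (simp_all add: convolution_delete_letter flip_def)
      moreover have "push s ?x = r"
        using push_flip[of r ?x] calculation by simp
      ultimately show ?thesis
        using s by (auto simp: a intro!: exI[of _ s])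
    qed
  qed
  moreover have "language (tail_automaton e n) \<in> counter_languages 0"
    using language_in_counter_languages[OF wf_tail_automaton[of e n]]
    by (simp add: tail_automaton_def[THEN arg_cong, of counters])
  ultimately show ?thesis
    using counter_languages_vimage_Int[OF encode_reduced_words_in_counter_languages] by simp
qed

section \<open>The free group on countably many generators\<close>

lemma F_inf_gens_symmetric:
  "F_inf_gens \<union> m_inv F_inf ` F_inf_gens = (\<lambda>x. word_class {1..} [x]) ` ({1..} \<times> UNIV)"
proof -
  have "m_inv F_inf ` F_inf_gens = (\<lambda>a. word_class {1..} [(a, False)]) ` {1..}"
    using inv_word_class[of _ "{1..} :: nat set"]
    by (auto simp: F_inf_gens_def F_inf_def free_generator_def image_image flip_def intro!: image_cong)
  moreover have "F_inf_gens = (\<lambda>a. word_class {1..} [(a, True)]) ` {1..}"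
    by (simp add: F_inf_gens_def free_generator_def)
  moreover have "({1..} :: nat set) \<times> (UNIV :: bool set) =
      (\<lambda>a. (a, True)) ` {1..} \<union> (\<lambda>a. (a, False)) ` {1..}"
    by (auto simp: image_iff)
  ultimately show ?thesis
    by (simp only: image_Un image_image)
qed

theorem proposition6p1:
  shows "\<exists>\<Lambda> :: nat set.
    graph_automatic (counter_languages 2) (counter_languages 2)
      F_inf (F_inf_gens \<union> m_inv F_inf ` F_inf_gens) \<Lambda>"
proof -
  let ?S = "{1..} :: nat set"
  let ?X = "(\<lambda>x. word_class ?S [x]) ` (?S \<times> UNIV)"
  let ?L = "encode ` reduced_words ?S"
  define \<phi> where "\<phi> = (\<lambda>u. word_class ?S (inv_into (reduced_words ?S) encode u))"
  have inj: "inj_on encode (reduced_words ?S)"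
    using inj_on_encode by (rule inj_on_subset) (auto simp: reduced_words_def)
  have \<phi>: "\<phi> (encode r) = word_class ?S r" if "r \<in> reduced_words ?S" for r
    using that inj by (simp add: \<phi>_def)
  have nf: "normal_form (free_group ?S) {..3} ?L \<phi>"
    unfolding normal_form_def
  proof
    show "?L \<subseteq> lists {..3}"
      using encode_in_lists by blast
    have "bij_betw (word_class ?S \<circ> inv_into (reduced_words ?S) encode) ?L (carrier (free_group ?S))"
      using bij_betw_inv_into[OF inj_on_imp_bij_betw[OF inj]] bij_betw_word_class
      by (rule bij_betw_trans)
    then show "bij_betw \<phi> ?L (carrier (free_group ?S))"
      by (simp add: \<phi>_def o_def)
  qed
  have mult: "{convolution u v | u v. u \<in> ?L \<and> v \<in> ?L \<and> \<phi> v = \<phi> u \<otimes>\<^bsub>free_group ?S\<^esub> g}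
      \<in> counter_languages 2" if g_in: "g \<in> ?X" for g
  proof -
    obtain a e where g: "g = word_class ?S [(a, e)]" and a: "a \<ge> 1"
      using g_in by auto
    have edge: "\<phi> (encode s) = \<phi> (encode r) \<otimes>\<^bsub>free_group ?S\<^esub> g \<longleftrightarrow> s = push r (a, e)"
      if r: "r \<in> reduced_words ?S" and s: "s \<in> reduced_words ?S" for r s
    proof -
      have x: "(a, e) \<in> ?S \<times> UNIV" using a by simp
      have "\<phi> (encode r) \<otimes>\<^bsub>free_group ?S\<^esub> g = word_class ?S (push r (a, e))"
        using r x by (simp add: \<phi> g word_class_push reduced_words_def)
      then show ?thesis
        using s push_in_reduced_words[OF r x]
        by (simp add: \<phi> inj_on_eq_iff[OF bij_betw_imp_inj_on[OF bij_betw_word_class]])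
    qed
    have "{convolution u v | u v. u \<in> ?L \<and> v \<in> ?L \<and> \<phi> v = \<phi> u \<otimes>\<^bsub>free_group ?S\<^esub> g} =
      {convolution (encode r) (encode (push r (a, e))) | r. r \<in> reduced_words ?S}"
      (is "?K = ?K'")
    proof (rule subset_antisym; rule subsetI)
      fix w assume "w \<in> ?K"
      then show "w \<in> ?K'"
        using edge by blast
    next
      fix w assume "w \<in> ?K'"
      then obtain r where "r \<in> reduced_words ?S" "w = convolution (encode r) (encode (push r (a, e)))"
        by blast
      moreover from this have "push r (a, e) \<in> reduced_words ?S"
        using a by (intro push_in_reduced_words) auto
      ultimately show "w \<in> ?K"
        using edge by blast
    qed
    then show ?thesis
      using push_language[OF a] by simp
  qed
  have inv: "inv\<^bsub>free_group ?S\<^esub> g \<in> ?X" if g_in: "g \<in> ?X" for g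
  proof -
    obtain x where "g = word_class ?S [x]" "x \<in> ?S \<times> UNIV"
      using g_in by blast
    then have "inv\<^bsub>free_group ?S\<^esub> g = word_class ?S [flip x]" "flip x \<in> ?S \<times> UNIV"
      using inv_word_class[of x ?S] by (auto simp: flip_def)
    then show ?thesis
      by (rule image_eqI)
  qed
  have "?X \<subseteq> carrier (free_group ?S)"
    by (subst generate_letters[symmetric]) (rule subsetI, rule generate.incl)
  then have "graph_automatic (counter_languages 2) (counter_languages 2) (free_group ?S) ?X {..3 :: nat}"
    unfolding graph_automatic_def
    by (intro conjI exI[of _ ?L] exI[of _ \<phi>] ballI group_free_group generate_letters nf mult inv
        finite_atMost encode_reduced_words_in_counter_languages)
  then show ?thesis
    unfolding F_inf_gens_symmetric F_inf_def[symmetric] by (rule exI)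
qed

end
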